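(* Let $X$ be a real Banach space with continuous dual $X^*$. Let $A\colon X\rightrightarrows X^*$ be a maximal monotone linear relation, let $f\colon X\to\left]-\infty,+\infty\right]$ be a proper lower semicontinuous sublinear function, and suppose that $\operatorname{dom} A\cap\operatorname{int}\operatorname{dom}\partial f\neq\varnothing$. Then $A+\partial f$ is maximal monotone.
   Context: $X$ is a real Banach space (not assumed reflexive), $X^*$ is its continuous dual, and $\langle\cdot,\cdot\rangle$ is the duality pairing. A set-valued operator $A\colon X\rightrightarrows X^*$ assigns to each $x\in X$ a subset $Ax\subseteq X^*$; its graph is $\operatorname{gra}A=\{(x,x^* )\in X\times X^*\mid x^*\in Ax\}$ and its domain is $\operatorname{dom}A=\{x\in X\mid Ax\neq\varnothing\}$. $A$ is monotone if $\langle x-y,x^*-y^*\rangle\ge 0$ for all $(x,x^* ),(y,y^* )\in\operatorname{gra}A$; it is maximal monotone if it is monotone and has no proper monotone extension (in the sense of graph inclusion). $A$ is a linear relation if $\operatorname{gra}A$ is a linear subspace of $X\times X^*$. The sum is $(A+B)x=\{a^*+b^*\mid a^*\in Ax,\ b^*\in Bx\}$. For $f\colon X\to\left]-\infty,+\infty\right]$, $\operatorname{dom}f=f^{-1}(\mathbb R)$; $f$ is proper if $\operatorname{dom}f\neq\varnothing$. $f$ is sublinear if $f(0)=0$, $f(x+y)\le f(x)+f(y)$ and $f(\lambda x)=\lambda f(x)$ for all $x,y\in\operatorname{dom}f$ and $\lambda>0$. For convex $f$ with $\operatorname{dom} f\neq\varnothing$, the subdifferential operator is $\partial f\colon X\rightrightarrows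 X^*$, $\partial f(x)=\{x^*\in X^*\mid \langle y-x,x^*\rangle+f(x)\le f(y)\ \text{for all } y\in X\}$. $\operatorname{int}$ denotes the norm interior in $X$. *)

theory Defs
  imports "HOL-Analysis.Analysis"
begin

type_synonym 'a dual = "'a \<Rightarrow>\<^sub>L real"

type_synonym 'a set_valued = "'a \<Rightarrow> 'a dual set"

definition gra :: "'a::real_normed_vector set_valued \<Rightarrow> ('a \<times> 'a dual) set" where
  "gra A = {(x, x'). x' \<in> A x}"

definition dom_op :: "'a::real_normed_vector set_valued \<Rightarrow> 'a set" where
  "dom_op A = {x. A x \<noteq> {}}"

definition monotone_op :: "'a::real_normed_vector set_valued \<Rightarrow> bool" where
  "monotone_op A \<longleftrightarrow>
     (\<forall>(x, x') \<in> gra A. \<forall>(y, y') \<in> gra A. 0 \<le> blinfun_apply (x' - y') (x - y))"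

definition maximal_monotone :: "'a::real_normed_vector set_valued \<Rightarrow> bool" where
  "maximal_monotone A \<longleftrightarrow>
     monotone_op A \<and> \<not> (\<exists>B. monotone_op B \<and> gra A \<subset> gra B)"

definition linear_relation :: "'a::real_normed_vector set_valued \<Rightarrow> bool" where
  "linear_relation A \<longleftrightarrow> subspace (gra A)"

definition sum_op :: "'a::real_normed_vector set_valued \<Rightarrow> 'a set_valued \<Rightarrow> 'a set_valued" where
  "sum_op A B x = {a' + b' | a' b'. a' \<in> A x \<and> b' \<in> B x}"

(* Functions into ]-\<infinity>, +\<infinity>] are rendered as ereal-valued functions; that the value
   -\<infinity> is not attained is a separate hypothesis wherever it is needed. *)

definition dom_fun :: "('a \<Rightarrow> ereal) \<Rightarrow> 'a set" where
  "dom_fun f = f -` range ereal"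

definition proper_fun :: "('a \<Rightarrow> ereal) \<Rightarrow> bool" where
  "proper_fun f \<longleftrightarrow> dom_fun f \<noteq> {}"

definition lower_semicontinuous :: "('a::topological_space \<Rightarrow> ereal) \<Rightarrow> bool" where
  "lower_semicontinuous f \<longleftrightarrow> (\<forall>x. \<forall>c < f x. \<forall>\<^sub>F y in nhds x. c < f y)"

definition sublinear :: "('a::real_vector \<Rightarrow> ereal) \<Rightarrow> bool" where
  "sublinear f \<longleftrightarrow>
     f 0 = 0 \<and>
     (\<forall>x \<in> dom_fun f. \<forall>y \<in> dom_fun f. f (x + y) \<le> f x + f y) \<and>
     (\<forall>x \<in> dom_fun f. \<forall>l > 0. f (l *\<^sub>R x) = ereal l * f x)"

(* At a point with f x = \<infinity> the inequality forces f to be identically \<infinity>, so for proper f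
   the subdifferential is empty outside dom_fun f. *)
definition subdiff :: "('a::real_normed_vector \<Rightarrow> ereal) \<Rightarrow> 'a set_valued" where
  "subdiff f x = {x'. \<forall>y. ereal (blinfun_apply x' (y - x)) + f x \<le> f y}"

end

theory Submission
  imports Defs
begin

text \<open>Let $(z, z')$ be monotonically related to the graph of $A + \partial f$, put $D = \mathrm{dom}\,A$
and $K = \mathrm{dom}\,f$, and let $x_0 \in D$ be the given interior point. The goal is a
splitting $z' = a + w$ with $a \in A z$ and $w \in \partial f(z)$.

The splitting comes from the gap inequality
  $f(z) \le f(x) + \langle z - x, z' - a\rangle$ for all $(x, a)$ in the graph of $A$ with
$x \in K$. Indeed the right-hand side is jointly convex when the argument of $f$ is decoupled
from the point of the graph of $A$, because the graph is a linear space on which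
$\langle x, a\rangle$ is a nonnegative quadratic form. As $f$ is bounded above near $x_0 \in D$
by Baire's theorem (\<open>bounded_above_near_interior\<close>),
the Hahn-Banach theorem yields a continuous functional $w$ paying for the decoupling
(\<open>sandwich_with_slope_bound\<close>). Putting the argument of $f$ equal to $z$ shows that
$(z, z' - w)$ is monotonically related to $A$, hence lies in its graph by maximality; now the
other argument may be put equal to $z$ as well, and $w \in \partial f(z)$ results
(\<open>monotone_relation_splitting\<close>).

The gap inequality needs three ingredients.
  Sublinearity gives $z \in K$: testing the relation at $(0, 0)$ in the graph of $A$ with
$c \in \partial f(0)$ gives $\langle z, c\rangle \le \langle z, z'\rangle$, and $f$ is the
supremum of such $c$ (\<open>sublinear_support_functional\<close>).
  Linearity gives $z \in \overline D$: the set $A 0$ contains the annihilator of $D$, a subspace,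
so the relation tested at $0$ forces $z$ to be annihilated by it, and separation does the rest
(\<open>related_point_in_closure_dom\<close>).
  Finally, let $f$ be bounded above near $x \in D$ and let $p$ be a point of the segment from
$x$ to $z$, other than $z$. Although $p$ need not belong to $D$, the splitting lemma applied to a
multiple of the distance to $p$, restricted to a small ball, produces graph points $(y, b)$ with
$y$ near $p$ at which $\langle p - y, z' - b\rangle$ is at most $-L\|p - y\|$
(\<open>graph_point_near_closure\<close>); here $L$ bounds the subgradients of $f$ near $p$. Decomposing
$z - y$ along $p - y$ and $y - x$ and using the monotonicity of $A$ between $x$ and $y$ then gives
$f(y) \le f(x) + \langle y - x, z' - a\rangle$, and $y$ can be made to tend to $z$
(\<open>approximate_gap_inequality\<close>). Lower semicontinuity yields the gap inequality at $x$, and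
convexity along the segment from $x$ to $x_0$ extends it to all $x \in D \cap K$
(\<open>gap_inequality_extends\<close>).\<close>

section \<open>The Hahn-Banach-Lagrange theorem\<close>

text \<open>Unlike \<^const>\<open>sublinear\<close>, this is for functionals that are finite everywhere.\<close>

definition real_sublinear :: "('a::real_vector \<Rightarrow> real) \<Rightarrow> bool" where
  "real_sublinear p \<longleftrightarrow>
     (\<forall>x y. p (x + y) \<le> p x + p y) \<and> (\<forall>x. \<forall>t\<ge>0. p (t *\<^sub>R x) = t * p x)"

lemma real_sublinearI:
  assumes "\<And>x y. p (x + y) \<le> p x + p y" "p 0 = 0"
    "\<And>t x. t > 0 \<Longrightarrow> p (t *\<^sub>R x) \<le> t * p x"
  shows "real_sublinear p"
proof -
  have "p (t *\<^sub>R x) = t * p x" if "t \<ge> 0" for t x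
  proof (cases "t = 0")
    case False
    then have t: "t > 0" using that by simp
    have "p (inverse t *\<^sub>R (t *\<^sub>R x)) \<le> inverse t * p (t *\<^sub>R x)"
      using t by (intro assms(3)) simp
    then have "t * p x \<le> p (t *\<^sub>R x)"
      using t by (simp add: field_simps)
    then show ?thesis using assms(3)[OF t, of x] by simp
  qed (simp add: assms(2))
  then show ?thesis unfolding real_sublinear_def using assms(1) by blast
qed

lemma real_sublinear_add: "real_sublinear p \<Longrightarrow> p (x + y) \<le> p x + p y"
  and real_sublinear_scale: "real_sublinear p \<Longrightarrow> t \<ge> 0 \<Longrightarrow> p (t *\<^sub>R x) = t * p x"
  by (auto simp: real_sublinear_def)

lemma real_sublinear_zero: "real_sublinear p \<Longrightarrow> p 0 = 0"
  using real_sublinear_scale[of p 0 0] by simp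

lemma real_sublinear_ge_neg: "real_sublinear p \<Longrightarrow> - p (- x) \<le> p x"
  using real_sublinear_add[of p x "- x"] by (simp add: real_sublinear_zero)

text \<open>The largest sublinear minorant of $p$ with $q(-j\,c) \le k\,c$ on $C$ is the infimum of
$p(u + t\,j\,c) + t\,k\,c$ over $t \ge 0$ and $c \in C$. The sign condition keeps this infimum
above $-p(-u)$, and convexity of $k$ makes it subadditive, since the sum of two nonnegative
multiples of points of $C$ is again such a multiple. With $C$ a singleton this drives the proof that minimal sublinear functionals
are linear; with general $C$ it turns the Hahn-Banach theorem into a Lagrange multiplier rule.\<close>

lemma sublinear_minorant_through_constraint:
  fixes p :: "'a::real_vector \<Rightarrow> real" and j :: "'b::real_vector \<Rightarrow> 'a"
  assumes p: "real_sublinear p" and j: "linear j" and k: "convex_on C k" and "C \<noteq> {}"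
    and nonneg: "\<And>c. c \<in> C \<Longrightarrow> 0 \<le> p (j c) + k c"
  obtains q where "real_sublinear q" "\<And>x. q x \<le> p x" "\<And>c. c \<in> C \<Longrightarrow> q (- j c) \<le> k c"
proof -
  define h where "h = (\<lambda>u (t::real, c). p (u + t *\<^sub>R j c) + t * k c)"
  define q where "q = (\<lambda>u. INF z\<in>{0..} \<times> C. h u z)"
  have lower: "- p (- u) \<le> h u (t, c)" if "t \<ge> 0" "c \<in> C" for u t c
  proof -
    have "t * p (j c) \<le> p (u + t *\<^sub>R j c) + p (- u)"
      using real_sublinear_add[OF p, of "u + t *\<^sub>R j c" "- u"] real_sublinear_scale[OF p that(1)]
      by simp
    moreover have "0 \<le> t * (p (j c) + k c)" using that nonneg by simp
    ultimately show ?thesis by (simp add: h_def algebra_simps)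
  qed
  have bdd: "bdd_below (h u ` ({0..} \<times> C))" for u
    using lower by (intro bdd_belowI[of _ "- p (- u)"]) auto
  have le: "q u \<le> h u (t, c)" if "t \<ge> 0" "c \<in> C" for u t c
    unfolding q_def using that by (intro cINF_lower[OF bdd]) auto
  have greatest: "m \<le> q u" if "\<And>t c. t \<ge> 0 \<Longrightarrow> c \<in> C \<Longrightarrow> m \<le> h u (t, c)" for m u
    unfolding q_def using that \<open>C \<noteq> {}\<close> by (intro cINF_greatest) auto
  obtain c0 where c0: "c0 \<in> C" using \<open>C \<noteq> {}\<close> by blast
  have qp: "q u \<le> p u" for u
    using le[of 0 c0 u] c0 by (simp add: h_def)
  have qk: "q (- j c) \<le> k c" if "c \<in> C" for c
    using le[of 1 c "- j c"] that by (simp add: h_def real_sublinear_zero[OF p])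
  have combine: "q (u + v) \<le> h u (s, c) + h v (t, d)"
    if "s \<ge> 0" "t \<ge> 0" "c \<in> C" "d \<in> C" for u v s t c d
  proof (cases "s + t = 0")
    case True
    then have "s = 0" "t = 0" using that by auto
    then show ?thesis
      using qp[of "u + v"] real_sublinear_add[OF p, of u v] by (simp add: h_def)
  next
    case False
    then have st: "s + t > 0" using that by auto
    define e where "e = (s / (s + t)) *\<^sub>R c + (t / (s + t)) *\<^sub>R d"
    have sum1: "s / (s + t) + t / (s + t) = 1"
      using st by (simp add: add_divide_distrib [symmetric])
    have e: "e \<in> C" "k e \<le> s / (s + t) * k c + t / (s + t) * k d"
      unfolding e_def using that st k
      by (auto intro!: convexD[OF convex_on_imp_convex[OF k] _ _ _ _ sum1]
          k[unfolded convex_on_def, THEN conjunct2, rule_format, OF that(3,4) _ _ sum1] simp del: times_divide_eq_left)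
    have "(s + t) * k e \<le> (s + t) * (s / (s + t) * k c + t / (s + t) * k d)"
      using e st by (intro mult_left_mono) auto
    also have "\<dots> = s * k c + t * k d"
      using st by (simp add: distrib_left)
    finally have ke: "(s + t) * k e \<le> s * k c + t * k d" .
    have "(s + t) *\<^sub>R j e = s *\<^sub>R j c + t *\<^sub>R j d"
      using st by (simp add: e_def linear_add[OF j] linear_scale[OF j] scaleR_add_right)
    then have eq: "u + v + (s + t) *\<^sub>R j e = (u + s *\<^sub>R j c) + (v + t *\<^sub>R j d)"
      by simp
    have "q (u + v) \<le> p (u + v + (s + t) *\<^sub>R j e) + (s + t) * k e"
      using le[of "s + t" e "u + v"] st e by (simp add: h_def)
    also have "\<dots> \<le> p (u + s *\<^sub>R j c) + p (v + t *\<^sub>R j d) + (s * k c + t * k d)"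
      unfolding eq using real_sublinear_add[OF p] ke by (intro add_mono) auto
    finally show ?thesis by (simp add: h_def)
  qed
  have "q (u + v) \<le> q u + q v" for u v
  proof -
    have "q (u + v) - h v (t, d) \<le> q u" if "t \<ge> 0" "d \<in> C" for t d
      using combine[OF _ that(1) _ that(2), of _ _ u v] by (intro greatest) (simp add: algebra_simps)
    then have "q (u + v) - q u \<le> q v"
      by (intro greatest) (simp add: algebra_simps)
    then show ?thesis by simp
  qed
  moreover have "q 0 = 0"
  proof (rule antisym)
    show "q 0 \<le> 0" using qp[of 0] by (simp add: real_sublinear_zero[OF p])
    show "0 \<le> q 0" using lower[of _ _ 0] by (intro greatest) (simp add: real_sublinear_zero[OF p])
  qed
  moreover have "q (r *\<^sub>R u) \<le> r * q u" if "r > 0" for r u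
  proof -
    have "q (r *\<^sub>R u) / r \<le> h u (t, c)" if "t \<ge> 0" "c \<in> C" for t c
    proof -
      have "q (r *\<^sub>R u) \<le> p (r *\<^sub>R u + (r * t) *\<^sub>R j c) + (r * t) * k c"
        using le[of "r * t" c "r *\<^sub>R u"] that \<open>r > 0\<close> by (simp add: h_def)
      also have "r *\<^sub>R u + (r * t) *\<^sub>R j c = r *\<^sub>R (u + t *\<^sub>R j c)"
        by (simp add: scaleR_add_right)
      also have "p \<dots> = r * p (u + t *\<^sub>R j c)"
        using real_sublinear_scale[OF p] \<open>r > 0\<close> by simp
      finally show ?thesis using \<open>r > 0\<close> by (simp add: h_def field_simps)
    qed
    then have "q (r *\<^sub>R u) / r \<le> q u" by (intro greatest)
    then show ?thesis using that by (simp add: field_simps)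
  qed
  ultimately have "real_sublinear q" by (intro real_sublinearI)
  then show ?thesis using qp qk that by blast
qed

text \<open>Zorn's lemma, for the order in which smaller functionals come later: a chain of sublinear
minorants of $p$ is bounded below by $-p(-x)$ at $x$, so its pointwise infimum is finite, and the
infimum is subadditive because any two members of the chain can be replaced by the smaller one.\<close>

lemma minimal_sublinear_exists:
  fixes p :: "'a::real_vector \<Rightarrow> real"
  assumes p: "real_sublinear p"
  obtains m where "real_sublinear m" "\<And>x. m x \<le> p x"
    "\<And>q. real_sublinear q \<Longrightarrow> (\<And>x. q x \<le> m x) \<Longrightarrow> q = m"
proof -
  define S where "S = {q. real_sublinear q \<and> (\<forall>x. q x \<le> p x)}"
  define P where "P = (\<lambda>q r :: 'a \<Rightarrow> real. \<forall>x. r x \<le> q x)"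
  have "\<exists>m\<in>S. \<forall>q\<in>S. P m q \<longrightarrow> q = m"
  proof (rule predicate_Zorn)
    show "partial_order_on S (relation_of P S)"
      by (auto simp: partial_order_on_def preorder_on_def refl_on_def trans_def antisym_def
          relation_of_def P_def intro: order_trans intro!: ext antisym)
  next
    fix C assume C: "C \<in> Chains (relation_of P S)"
    then have CS: "C \<subseteq> S" and total: "\<And>q r. q \<in> C \<Longrightarrow> r \<in> C \<Longrightarrow> P q r \<or> P r q"
      by (auto simp: Chains_def relation_of_def)
    show "\<exists>u\<in>S. \<forall>q\<in>C. P q u"
    proof (cases "C = {}")
      case True
      then show ?thesis using p by (auto simp: S_def)
    next
      case False
      define u where "u = (\<lambda>x. INF q\<in>C. q x)"
      have sub: "real_sublinear q" "q x \<le> p x" if "q \<in> C" for q x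
        using CS that by (auto simp: S_def)
      have low: "- p (- x) \<le> q x" if "q \<in> C" for q x
        using real_sublinear_ge_neg[OF sub(1)[OF that], of x] sub(2)[OF that, of "- x"] by simp
      have bdd: "bdd_below ((\<lambda>q. q x) ` C)" for x
        using low by (intro bdd_belowI[of _ "- p (- x)"]) auto
      have le: "u x \<le> q x" if "q \<in> C" for q x
        unfolding u_def using that by (intro cINF_lower[OF bdd])
      have greatest: "m \<le> u x" if "\<And>q. q \<in> C \<Longrightarrow> m \<le> q x" for m x
        unfolding u_def using that False by (intro cINF_greatest)
      obtain q0 where q0: "q0 \<in> C" using False by blast
      have "u (x + y) \<le> u x + u y" for x y
      proof -
        have *: "u (x + y) \<le> q x + r y" if "q \<in> C" "r \<in> C" for q r
        proof (cases "P q r")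
          case True
          then have "u (x + y) \<le> r x + r y"
            using le[OF that(2), of "x + y"] real_sublinear_add[OF sub(1)[OF that(2)], of x y] by simp
          then show ?thesis using True by (smt (verit) P_def)
        next
          case False
          then have "P r q" using total that by blast
          moreover have "u (x + y) \<le> q x + q y"
            using le[OF that(1), of "x + y"] real_sublinear_add[OF sub(1)[OF that(1)], of x y] by simp
          ultimately show ?thesis by (smt (verit) P_def)
        qed
        have "u (x + y) - r y \<le> u x" if "r \<in> C" for r
          using *[OF _ that] by (intro greatest) (simp add: algebra_simps)
        then have "u (x + y) - u x \<le> u y"
          by (intro greatest) (simp add: algebra_simps)
        then show ?thesis by simp
      qed
      moreover have "u 0 = 0"
        using False sub(1) by (simp add: u_def real_sublinear_zero cong: INF_cong)
      moreover have "u (t *\<^sub>R x) \<le> t * u x" if "t > 0" for t x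
      proof -
        have "u (t *\<^sub>R x) / t \<le> q x" if "q \<in> C" for q
          using le[OF that, of "t *\<^sub>R x"] real_sublinear_scale[OF sub(1)[OF that], of t x] \<open>t > 0\<close>
          by (simp add: field_simps)
        then have "u (t *\<^sub>R x) / t \<le> u x" by (rule greatest)
        then show ?thesis using that by (simp add: field_simps)
      qed
      ultimately have "real_sublinear u" by (intro real_sublinearI)
      moreover have "u x \<le> p x" for x
        using le[OF q0, of x] sub(2)[OF q0, of x] by simp
      ultimately show ?thesis using le by (auto simp: S_def P_def)
    qed
  qed
  then obtain m where m: "m \<in> S" "\<And>q. q \<in> S \<Longrightarrow> P m q \<Longrightarrow> q = m" by blast
  show ?thesis
  proof (rule that[of m])
    show "real_sublinear m" "m x \<le> p x" for x using m(1) by (auto simp: S_def)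
    fix q assume "real_sublinear q" "\<And>x. q x \<le> m x"
    moreover from this have "q x \<le> p x" for x using m(1) by (auto simp: S_def intro: order_trans)
    ultimately show "q = m" by (intro m(2)) (auto simp: S_def P_def)
  qed
qed

text \<open>Imposing the constraint $q(-y) \le -m(y)$ on a minimal sublinear $m$ yields a sublinear
minorant of $m$, which is $m$ itself; so $m(-y) = -m(y)$ for all $y$, which makes $m$ linear.\<close>

theorem Hahn_Banach_sublinear:
  fixes p :: "'a::real_vector \<Rightarrow> real"
  assumes "real_sublinear p"
  obtains g where "linear g" "\<And>x. g x \<le> p x"
proof -
  obtain m where m: "real_sublinear m" "\<And>x. m x \<le> p x"
    and min: "\<And>q. real_sublinear q \<Longrightarrow> (\<And>x. q x \<le> m x) \<Longrightarrow> q = m"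
    using minimal_sublinear_exists[OF assms] by blast
  have neg: "m (- y) \<le> - m y" for y
  proof -
    obtain q where q: "real_sublinear q" "\<And>x. q x \<le> m x" "q (- y) \<le> - m y"
      using sublinear_minorant_through_constraint[OF m(1) linear_id, of "{y}" "\<lambda>_. - m y"]
      by (auto simp: convex_on_const)
    then show ?thesis using min[of q] by simp
  qed
  have negeq: "m (- y) = - m y" for y
    using neg[of y] real_sublinear_ge_neg[OF m(1), of y] by simp
  have "linear m"
  proof (rule linearI)
    fix x y
    have "m x \<le> m (x + y) + m (- y)"
      using real_sublinear_add[OF m(1), of "x + y" "- y"] by simp
    then show "m (x + y) = m x + m y"
      using real_sublinear_add[OF m(1), of x y] negeq[of y] by simp
  next
    fix t x
    show "m (t *\<^sub>R x) = t *\<^sub>R m x"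
    proof (cases "t \<ge> 0")
      case False
      then have "m (t *\<^sub>R x) = - m ((- t) *\<^sub>R x)" using negeq[of "(- t) *\<^sub>R x"] by simp
      then show ?thesis using False real_sublinear_scale[OF m(1), of "- t" x] by simp
    qed (simp add: real_sublinear_scale[OF m(1)])
  qed
  then show ?thesis using m(2) that by blast
qed

text \<open>This is Simons's Hahn-Banach-Lagrange theorem in the normalisation where the infimum is
nonnegative. Every separation and duality argument below is an instance of it, with $p$ a
multiple of the norm.\<close>

theorem Hahn_Banach_Lagrange:
  fixes p :: "'a::real_vector \<Rightarrow> real" and j :: "'b::real_vector \<Rightarrow> 'a"
  assumes "real_sublinear p" "linear j" "convex_on C k" "C \<noteq> {}"
    and "\<And>c. c \<in> C \<Longrightarrow> 0 \<le> p (j c) + k c"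
  obtains g where "linear g" "\<And>x. g x \<le> p x" "\<And>c. c \<in> C \<Longrightarrow> 0 \<le> g (j c) + k c"
proof -
  obtain q where q: "real_sublinear q" "\<And>x. q x \<le> p x" "\<And>c. c \<in> C \<Longrightarrow> q (- j c) \<le> k c"
    using sublinear_minorant_through_constraint[OF assms] by blast
  obtain g where g: "linear g" "\<And>x. g x \<le> q x" using Hahn_Banach_sublinear[OF q(1)] by blast
  show ?thesis
  proof (rule that[OF g(1)])
    show "g x \<le> p x" for x using g(2)[of x] q(2)[of x] by simp
    show "0 \<le> g (j c) + k c" if "c \<in> C" for c
      using g(2)[of "- j c"] q(3)[OF that] linear_neg[OF g(1), of "j c"] by simp
  qed
qed

corollary bounded_Hahn_Banach_Lagrange:
  fixes j :: "'b::real_vector \<Rightarrow> 'a::real_normed_vector"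
  assumes "linear j" "convex_on C k" "C \<noteq> {}" "0 \<le> M"
    and "\<And>c. c \<in> C \<Longrightarrow> 0 \<le> M * norm (j c) + k c"
  obtains w :: "'a \<Rightarrow>\<^sub>L real" where "norm w \<le> M" "\<And>c. c \<in> C \<Longrightarrow> 0 \<le> blinfun_apply w (j c) + k c"
proof -
  have "real_sublinear (\<lambda>x::'a. M * norm x)"
    using \<open>0 \<le> M\<close> by (auto simp: real_sublinear_def distrib_left[symmetric] intro!: mult_left_mono norm_triangle_ineq)
  then obtain g where g: "linear g" "\<And>x::'a. g x \<le> M * norm x"
    "\<And>c. c \<in> C \<Longrightarrow> 0 \<le> g (j c) + k c"
    using Hahn_Banach_Lagrange[of "\<lambda>x. M * norm x" j C k] assms by blast
  have absle: "\<bar>g x\<bar> \<le> M * norm x" for x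
    using g(2)[of x] g(2)[of "- x"] linear_neg[OF g(1), of x] by simp
  have "bounded_linear g"
    using g(1) absle by (intro bounded_linear_intro[of g M])
      (auto simp: linear_add linear_scale mult.commute)
  then have app: "blinfun_apply (Blinfun g) = g" by (rule bounded_linear_Blinfun_apply)
  show ?thesis
  proof (rule that[of "Blinfun g"])
    show "norm (Blinfun g) \<le> M" using absle \<open>0 \<le> M\<close> by (intro norm_blinfun_bound) (auto simp: app)
  qed (use g(3) in \<open>simp add: app\<close>)
qed

text \<open>The distance of $z$ from $D$ is a positive number $e$, so $\|z - d\| - e \ge 0$ on $D$, and the norm can
be replaced by a linear functional. That functional is bounded above on the subspace $D$, hence
zero there.\<close>

lemma separation_from_subspace:
  fixes D :: "'a::real_normed_vector set"
  assumes D: "subspace D" and z: "z \<notin> closure D"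
  obtains w :: "'a \<Rightarrow>\<^sub>L real" where "\<And>d. d \<in> D \<Longrightarrow> blinfun_apply w d = 0" "blinfun_apply w z > 0"
proof -
  obtain e where e: "e > 0" "\<And>d. d \<in> D \<Longrightarrow> e \<le> dist d z"
    using z unfolding closure_approachable by (meson not_less)
  have conv: "convex_on ((\<lambda>d. z - d) ` D) (\<lambda>_. - e)"
    using convex_translation[OF convex_negations[OF subspace_imp_convex[OF D]], of z]
    by (simp add: convex_on_const image_image)
  obtain w :: "'a \<Rightarrow>\<^sub>L real" where w: "\<And>c. c \<in> (\<lambda>d. z - d) ` D \<Longrightarrow> 0 \<le> blinfun_apply w (id c) + - e"
  proof (rule bounded_Hahn_Banach_Lagrange[OF linear_id conv, of 1])
    show "(\<lambda>d. z - d) ` D \<noteq> {}" using subspace_0[OF D] by blast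
    show "0 \<le> 1 * norm (id c) + - e" if "c \<in> (\<lambda>d. z - d) ` D" for c
      using that e(2) by (auto simp: dist_norm norm_minus_commute)
  qed auto
  have bound: "e \<le> blinfun_apply w z - blinfun_apply w d" if "d \<in> D" for d
    using w[of "z - d"] that by (simp add: blinfun.bilinear_simps)
  have le0: "blinfun_apply w d \<le> 0" if "d \<in> D" for d
  proof (rule ccontr)
    assume *: "\<not> ?thesis"
    \<comment> \<open>The multiple of $d$ at which the functional takes the same value as at $z$.\<close>
    have "(blinfun_apply w z / blinfun_apply w d) *\<^sub>R d \<in> D" using D that by (rule subspace_scale)
    from bound[OF this] show False using * e(1) by (simp add: blinfun.bilinear_simps)
  qed
  show ?thesis
  proof (rule that[of w])
    show "blinfun_apply w d = 0" if "d \<in> D" for d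
      using le0[OF that] le0[OF subspace_neg[OF D that]] by (simp add: blinfun.bilinear_simps)
    show "blinfun_apply w z > 0" using bound[OF subspace_0[OF D]] e(1) by (simp add: blinfun.bilinear_simps)
  qed
qed

text \<open>The inequality $f(j\,c) + h\,c \ge 0$ on the diagonal survives decoupling the two arguments if
the mismatch is penalised by $M \|j\,c - x\|$: moving $c$ towards $c_0$
and $x$ towards a suitable point of the ball on which $f$ is bounded, one arrives at an admissible
diagonal point, and the price is proportional to the mismatch. The penalty is then linearised. The explicit
bound on the slope is what makes subgradients uniformly bounded near interior points.\<close>

lemma sandwich_with_slope_bound:
  fixes f :: "'a::real_normed_vector \<Rightarrow> real" and j :: "'b::real_vector \<Rightarrow> 'a"
  assumes f: "convex_on K f" and h: "convex_on C h" and j: "linear j"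
    and nonneg: "\<And>c. c \<in> C \<Longrightarrow> j c \<in> K \<Longrightarrow> 0 \<le> f (j c) + h c"
    and c0: "c0 \<in> C" and r: "r > 0" and ball: "cball (j c0) r \<subseteq> K"
    and N: "\<And>x. x \<in> cball (j c0) r \<Longrightarrow> f x \<le> N"
  obtains w :: "'a \<Rightarrow>\<^sub>L real" where "norm w \<le> (N + h c0) / r"
    "\<And>x c. x \<in> K \<Longrightarrow> c \<in> C \<Longrightarrow> 0 \<le> f x + h c + blinfun_apply w (j c - x)"
proof -
  define M where "M = (N + h c0) / r"
  have x0: "j c0 \<in> cball (j c0) r" using r by simp
  have "0 \<le> N + h c0" using nonneg[OF c0] N[OF x0] ball x0 by force
  then have M0: "0 \<le> M" using r by (simp add: M_def)
  have key: "0 \<le> M * norm (j c - x) + (f x + h c)" if x: "x \<in> K" and c: "c \<in> C" for x c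
  proof -
    define d where "d = norm (j c - x)"
    have d0: "0 \<le> d" by (simp add: d_def)
    \<comment> \<open>This weight makes the correction inside the ball have norm exactly $r$, as $s r / d = 1 - s$
      unless $d = 0$.\<close>
    define s where "s = d / (d + r)"
    have s: "0 \<le> s" "s \<le> 1" "1 - s = r / (d + r)" using r d0 by (auto simp: s_def field_simps)
    define e where "e = (1 - s) *\<^sub>R c + s *\<^sub>R c0"
    define y where "y = j c0 + (r / d) *\<^sub>R (j c - x)"
    have y: "y \<in> cball (j c0) r"
      using r by (cases "d = 0") (auto simp: y_def dist_norm d_def)
    have je: "j e = (1 - s) *\<^sub>R x + s *\<^sub>R y"
    proof (cases "d = 0")
      case True
      then show ?thesis
        by (simp add: d_def e_def y_def s_def)
    next
      case False
      then have "s * (r / d) = 1 - s" using s(3) r d0 by (simp add: s_def)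
      then show ?thesis
        by (simp add: e_def y_def linear_add[OF j] linear_scale[OF j] scaleR_add_right scaleR_diff_right)
    qed
    have eC: "e \<in> C" "h e \<le> (1 - s) * h c + s * h c0"
      using convex_onD[OF h s(1,2) c c0] convexD[OF convex_on_imp_convex[OF h] c c0, of "1 - s" s] s
      by (auto simp: e_def)
    have jK: "j e \<in> K" "f (j e) \<le> (1 - s) * f x + s * f y"
      using convex_onD[OF f s(1,2) x, of y] convexD[OF convex_on_imp_convex[OF f] x, of y "1 - s" s]
        s y ball by (auto simp: je)
    have "0 \<le> f (j e) + h e" using nonneg[OF eC(1) jK(1)] .
    also have "\<dots> \<le> (1 - s) * (f x + h c) + s * (N + h c0)"
      using eC(2) jK(2) mult_left_mono[OF N[OF y] s(1)] by (simp add: algebra_simps)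
    also have "s * (N + h c0) = (r / (d + r)) * (M * d)"
      using r by (simp add: s_def M_def)
    also have "(1 - s) * (f x + h c) + (r / (d + r)) * (M * d)
        = (r / (d + r)) * (M * d + (f x + h c))"
      by (simp add: s(3) distrib_left)
    finally show ?thesis using r d0 by (auto simp: zero_le_mult_iff zero_le_divide_iff simp flip: d_def)
  qed
  have conv: "convex_on (K \<times> C) (\<lambda>(x, c). f x + h c)"
  proof (rule convex_onI)
    show "convex (K \<times> C)"
      using f h by (intro convex_Times convex_on_imp_convex)
    fix t :: real and u v :: "'a \<times> 'b"
    assume "0 < t" "t < 1" "u \<in> K \<times> C" "v \<in> K \<times> C"
    then show "(case (1 - t) *\<^sub>R u + t *\<^sub>R v of (x, c) \<Rightarrow> f x + h c)
        \<le> (1 - t) * (case u of (x, c) \<Rightarrow> f x + h c) + t * (case v of (x, c) \<Rightarrow> f x + h c)"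
      using convex_onD[OF f, of t "fst u" "fst v"] convex_onD[OF h, of t "snd u" "snd v"]
      by (auto simp: case_prod_beta algebra_simps)
  qed
  have lin: "linear (\<lambda>(x, c). j c - x)"
    by (rule linearI) (auto simp: linear_add[OF j] linear_scale[OF j] scaleR_diff_right)
  have "K \<times> C \<noteq> {}" using ball x0 c0 by blast
  then obtain w :: "'a \<Rightarrow>\<^sub>L real" where w: "norm w \<le> M"
    "\<And>z. z \<in> K \<times> C \<Longrightarrow> 0 \<le> blinfun_apply w ((\<lambda>(x, c). j c - x) z) + (\<lambda>(x, c). f x + h c) z"
  proof (rule bounded_Hahn_Banach_Lagrange[OF lin conv _ M0])
    fix z assume "z \<in> K \<times> C"
    then show "0 \<le> M * norm ((\<lambda>(x, c). j c - x) z) + (\<lambda>(x, c). f x + h c) z"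
      using key by (cases z) simp
  qed blast
  show ?thesis
  proof (rule that[of w])
    show "norm w \<le> (N + h c0) / r" using w(1) by (simp add: M_def)
    show "0 \<le> f x + h c + blinfun_apply w (j c - x)" if "x \<in> K" "c \<in> C" for x c
      using w(2)[of "(x, c)"] that by simp
  qed
qed

section \<open>Monotone linear relations\<close>

lemma monotone_opD:
  "monotone_op A \<Longrightarrow> a \<in> A x \<Longrightarrow> b \<in> A y \<Longrightarrow> 0 \<le> blinfun_apply (a - b) (x - y)"
  unfolding monotone_op_def gra_def by blast

lemma maximal_monotoneI:
  assumes A: "monotone_op A"
    and max: "\<And>z z'. (\<And>x a. a \<in> A x \<Longrightarrow> 0 \<le> blinfun_apply (z' - a) (z - x)) \<Longrightarrow> z' \<in> A z"
  shows "maximal_monotone A"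
  unfolding maximal_monotone_def
proof (intro conjI notI A)
  assume "\<exists>B. monotone_op B \<and> gra A \<subset> gra B"
  then obtain B where B: "monotone_op B" and sub: "gra A \<subset> gra B" by blast
  then obtain z z' where z: "z' \<in> B z" "z' \<notin> A z" by (auto simp: gra_def)
  have "0 \<le> blinfun_apply (z' - a) (z - x)" if "a \<in> A x" for x a
    using monotone_opD[OF B z(1), of a x] that sub by (auto simp: gra_def)
  then show False using max z(2) by blast
qed

lemma maximal_monotoneD:
  assumes "maximal_monotone A"
    and rel: "\<And>x a. a \<in> A x \<Longrightarrow> 0 \<le> blinfun_apply (z' - a) (z - x)"
  shows "z' \<in> A z"
proof (rule ccontr)
  assume new: "z' \<notin> A z"
  define B where "B = A(z := insert z' (A z))"
  have A: "monotone_op A" using assms(1) by (simp add: maximal_monotone_def)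
  have mem: "b \<in> B y \<longleftrightarrow> b \<in> A y \<or> (y = z \<and> b = z')" for b y by (auto simp: B_def)
  have rel': "0 \<le> blinfun_apply (a - z') (x - z)" if "a \<in> A x" for x a
    using rel[OF that] by (simp add: blinfun.bilinear_simps)
  have "0 \<le> blinfun_apply (b - c) (x - y)" if "b \<in> B x" "c \<in> B y" for x y b c
    using that[unfolded mem] monotone_opD[OF A, of b x c y] rel[of c y] rel'[of b x] by fastforce
  then have "monotone_op B" unfolding monotone_op_def gra_def by blast
  moreover have "gra A \<subset> gra B" using new by (auto simp: gra_def mem)
  ultimately show False using assms(1) by (auto simp: maximal_monotone_def)
qed

lemma linear_relation_combine:
  assumes "linear_relation A" "a \<in> A x" "b \<in> A y"
  shows "s *\<^sub>R a + t *\<^sub>R b \<in> A (s *\<^sub>R x + t *\<^sub>R y)"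
  using subspace_add[OF _ subspace_scale[of "gra A" "(x, a)" s] subspace_scale[of "gra A" "(y, b)" t]] assms
  by (auto simp: linear_relation_def gra_def)

lemma linear_relation_zero: "linear_relation A \<Longrightarrow> 0 \<in> A 0"
  using subspace_0[of "gra A"] by (simp add: linear_relation_def gra_def zero_prod_def)

lemma subspace_dom_op:
  assumes "linear_relation A"
  shows "subspace (dom_op A)"
proof -
  have "dom_op A = fst ` gra A" by (force simp: dom_op_def gra_def)
  then show ?thesis
    using assms linear_subspace_image[OF linear_fst] by (simp add: linear_relation_def)
qed

text \<open>On the linear space \<^term>\<open>gra A\<close> the expression is affine apart from the quadratic form
$\langle y, a\rangle$, which is nonnegative there by monotonicity.\<close>

lemma convex_on_monotone_gap:
  assumes "linear_relation A" and mono: "monotone_op A"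
  shows "convex_on (gra A) (\<lambda>(y, a). blinfun_apply (z' - a) (z - y))"
proof (rule convex_onI)
  show "convex (gra A)" using assms(1) by (simp add: linear_relation_def subspace_imp_convex)
  fix t :: real and u v :: "'a \<times> 'a dual"
  assume t: "0 < t" "t < 1" and "u \<in> gra A" "v \<in> gra A"
  moreover obtain x a y b where uv: "u = (x, a)" "v = (y, b)" by fastforce
  ultimately have "0 \<le> blinfun_apply (a - b) (x - y)"
    using monotone_opD[OF mono] by (auto simp: gra_def)
  then have "0 \<le> ((1 - t) * t) * blinfun_apply (a - b) (x - y)" using t by simp
  then show "(case (1 - t) *\<^sub>R u + t *\<^sub>R v of (y, a) \<Rightarrow> blinfun_apply (z' - a) (z - y))
      \<le> (1 - t) * (case u of (y, a) \<Rightarrow> blinfun_apply (z' - a) (z - y))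
        + t * (case v of (y, a) \<Rightarrow> blinfun_apply (z' - a) (z - y))"
    by (simp add: uv blinfun.bilinear_simps algebra_simps power2_eq_square)
qed

text \<open>Duality for the sum of $A$ and a convex function $g$: the sandwich functional $w$, tested with
$x = z$, makes $(z, z' - w)$ monotonically related to $A$. By maximality this point
lies in the graph, and testing $w$ with it shows that $w$ is a subgradient of $g$ at $z$.\<close>

lemma monotone_relation_splitting:
  fixes A :: "'a::real_normed_vector set_valued"
  assumes A: "maximal_monotone A" "linear_relation A" and g: "convex_on K g" and z: "z \<in> K"
    and nonneg: "\<And>y a. a \<in> A y \<Longrightarrow> y \<in> K \<Longrightarrow> 0 \<le> blinfun_apply (z' - a) (z - y) + (g y - g z)"
    and x0: "x0 \<in> dom_op A" and r: "r > 0" and ball: "cball x0 r \<subseteq> K"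
    and N: "\<And>x. x \<in> cball x0 r \<Longrightarrow> g x \<le> N"
  obtains w where "z' - w \<in> A z" "\<And>x. x \<in> K \<Longrightarrow> g z + blinfun_apply w (x - z) \<le> g x"
proof -
  have mono: "monotone_op A" using A by (simp add: maximal_monotone_def)
  define h where "h = (\<lambda>(y, a). blinfun_apply (z' - a) (z - y) + - g z)"
  obtain a0 where a0: "a0 \<in> A x0" using x0 by (auto simp: dom_op_def)
  have h: "convex_on (gra A) h"
    using convex_on_add[OF convex_on_monotone_gap[OF A(2) mono, of z' z],
        of "\<lambda>_. - g z"] A(2)
    by (simp add: h_def convex_on_const linear_relation_def subspace_imp_convex case_prod_beta')
  have fst_lin: "linear (fst :: 'a \<times> 'a dual \<Rightarrow> 'a)" by (rule linear_fst)
  obtain w :: "'a dual" where w: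
    "\<And>x c. x \<in> K \<Longrightarrow> c \<in> gra A \<Longrightarrow> 0 \<le> g x + h c + blinfun_apply w (fst c - x)"
  proof (rule sandwich_with_slope_bound[OF g h fst_lin, of "(x0, a0)" r N])
    show "0 \<le> g (fst c) + h c" if "c \<in> gra A" "fst c \<in> K" for c
      using nonneg[of "snd c" "fst c"] that by (auto simp: h_def gra_def case_prod_beta)
  qed (use a0 r ball N in \<open>auto simp: gra_def\<close>)
  have mem: "z' - w \<in> A z"
  proof (rule maximal_monotoneD[OF A(1)])
    fix x a assume "a \<in> A x"
    then show "0 \<le> blinfun_apply (z' - w - a) (z - x)"
      using w[OF z, of "(x, a)"] by (simp add: h_def gra_def blinfun.bilinear_simps)
  qed
  moreover have "g z + blinfun_apply w (x - z) \<le> g x" if "x \<in> K" for x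
    using w[OF that, of "(z, z' - w)"] mem by (simp add: h_def gra_def blinfun.bilinear_simps)
  ultimately show ?thesis using that by blast
qed

text \<open>If the strict reverse inequality held at all graph points over the ball around $p$, then splitting
with $g(y) = L \|p - y\|$ on that ball would put $p$ into the domain of $A$; but at $y = p$ both
sides of the inequality vanish.\<close>

lemma graph_point_near_closure:
  fixes A :: "'a::real_normed_vector set_valued"
  assumes A: "maximal_monotone A" "linear_relation A" and p: "p \<in> closure (dom_op A)"
    and "\<rho> > 0" and "L \<ge> 0"
  obtains y b where "b \<in> A y" "dist y p < \<rho>" "blinfun_apply (w' - b) (p - y) \<le> - L * norm (p - y)"
proof (rule ccontr)
  note found = that
  assume neg: "\<not> thesis"
  have none: "- L * norm (p - y) < blinfun_apply (w' - b) (p - y)"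
    if "b \<in> A y" "dist y p < \<rho>" for y b
  proof (rule ccontr)
    assume "\<not> ?thesis"
    then have thesis using found[OF \<open>b \<in> A y\<close> \<open>dist y p < \<rho>\<close>] by simp
    with neg show False ..
  qed
  obtain x0 where x0: "x0 \<in> dom_op A" "dist x0 p < \<rho>"
    using p \<open>\<rho> > 0\<close> by (auto simp: closure_approachable)
  have "open (ball p \<rho>)" "x0 \<in> ball p \<rho>" using x0 by (auto simp: dist_commute)
  then obtain r where r: "r > 0" "cball x0 r \<subseteq> ball p \<rho>" using open_contains_cball by blast
  have conv: "convex_on (ball p \<rho>) (\<lambda>y. L * norm (p - y))"
    using convex_on_cmul[OF \<open>L \<ge> 0\<close> convex_on_dist[OF convex_ball, of p \<rho> p]] by (simp add: dist_norm)
  obtain w where "w' - w \<in> A p"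
  proof (rule monotone_relation_splitting[OF A conv, of p w' x0 r "L * \<rho>"])
    show "0 \<le> blinfun_apply (w' - a) (p - y) + (L * norm (p - y) - L * norm (p - p))"
      if "a \<in> A y" "y \<in> ball p \<rho>" for y a
      using none[OF that(1)] that(2) by (simp add: dist_commute)
    show "L * norm (p - x) \<le> L * \<rho>" if "x \<in> cball x0 r" for x
    proof (rule mult_left_mono)
      have "x \<in> ball p \<rho>" using that r(2) by blast
      then show "norm (p - x) \<le> \<rho>" by (simp add: dist_norm)
    qed fact
  qed (use x0 r \<open>\<rho> > 0\<close> in auto)
  then show False using none[of "w' - w" p] \<open>\<rho> > 0\<close> by simp
qed

text \<open>If $w$ vanishes on the domain, then $(0, w)$ is monotonically related to $A$, because
$\langle x, a\rangle \ge 0$ on the graph of a monotone linear relation.\<close>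

lemma orthogonal_imp_in_value_at_zero:
  assumes A: "maximal_monotone A" "linear_relation A"
    and w: "\<And>x. x \<in> dom_op A \<Longrightarrow> blinfun_apply w x = 0"
  shows "w \<in> A 0"
proof (rule maximal_monotoneD[OF A(1)])
  fix x a assume a: "a \<in> A x"
  have "0 \<le> blinfun_apply (a - 0) (x - 0)"
    using A(1) by (intro monotone_opD[of A a x 0 0] a linear_relation_zero[OF A(2)])
      (simp add: maximal_monotone_def)
  moreover have "blinfun_apply w x = 0" using w[of x] a by (auto simp: dom_op_def)
  ultimately show "0 \<le> blinfun_apply (w - a) (0 - x)" by (simp add: blinfun.bilinear_simps)
qed

text \<open>The set $A 0$ contains every multiple of every functional that vanishes on the domain of $A$, so
the hypothesis bounds all multiples of the value of such a functional at $z$ from above.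
If $z$ were outside the closure of the domain, separation would give such a functional with a
positive value at $z$.\<close>

lemma related_point_in_closure_dom:
  fixes A :: "'a::real_normed_vector set_valued"
  assumes A: "maximal_monotone A" "linear_relation A"
    and rel: "\<And>a. a \<in> A 0 \<Longrightarrow> 0 \<le> blinfun_apply (z' - (a + c)) z"
  shows "z \<in> closure (dom_op A)"
proof (rule ccontr)
  assume "z \<notin> closure (dom_op A)"
  then obtain w :: "'a dual" where w: "\<And>d. d \<in> dom_op A \<Longrightarrow> blinfun_apply w d = 0" "blinfun_apply w z > 0"
    using separation_from_subspace[OF subspace_dom_op[OF A(2)]] by blast
  define l where "l = (\<bar>blinfun_apply (z' - c) z\<bar> + 1) / blinfun_apply w z"
  have "l *\<^sub>R w \<in> A 0"
    using w(1) by (intro orthogonal_imp_in_value_at_zero[OF A]) (simp add: blinfun.bilinear_simps)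
  from rel[OF this] have "l * blinfun_apply w z \<le> blinfun_apply (z' - c) z"
    by (simp add: blinfun.bilinear_simps)
  moreover have "l * blinfun_apply w z = \<bar>blinfun_apply (z' - c) z\<bar> + 1" using w(2) by (simp add: l_def)
  ultimately show False by linarith
qed

section \<open>Convex functions and their subgradients\<close>

definition real_part :: "('a \<Rightarrow> ereal) \<Rightarrow> 'a \<Rightarrow> real" where
  "real_part f x = real_of_ereal (f x)"

lemma real_part_eq [simp]: "f x = ereal u \<Longrightarrow> real_part f x = u"
  by (simp add: real_part_def)

lemma dom_fun_real_part: "x \<in> dom_fun f \<Longrightarrow> f x = ereal (real_part f x)"
  by (cases "f x") (auto simp: dom_fun_def real_part_def)

lemma dom_funE:
  assumes "x \<in> dom_fun f"
  obtains u where "f x = ereal u"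
  using assms that unfolding dom_fun_def by blast

lemma not_dom_fun: "f x \<noteq> -\<infinity> \<Longrightarrow> x \<notin> dom_fun f \<Longrightarrow> f x = \<infinity>"
  by (cases "f x") (auto simp: dom_fun_def)

text \<open>A real-valued version of the subdifferential, relative to a set $K$ that stands for the domain of
the extended real-valued function; it keeps the convexity arguments free of infinite values.\<close>

definition subgradient_on :: "'a::real_normed_vector set \<Rightarrow> ('a \<Rightarrow> real) \<Rightarrow> 'a \<Rightarrow> 'a dual \<Rightarrow> bool" where
  "subgradient_on K g x c \<longleftrightarrow> x \<in> K \<and> (\<forall>y\<in>K. g x + blinfun_apply c (y - x) \<le> g y)"

lemma subdiff_iff_subgradient_on:
  assumes fin: "\<And>x. f x \<noteq> -\<infinity>" and "proper_fun f"
  shows "c \<in> subdiff f x \<longleftrightarrow> subgradient_on (dom_fun f) (real_part f) x c"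
proof
  assume c: "c \<in> subdiff f x"
  then have le: "ereal (blinfun_apply c (y - x)) + f x \<le> f y" for y by (simp add: subdiff_def)
  obtain y where y: "y \<in> dom_fun f" using assms(2) by (auto simp: proper_fun_def)
  have x: "x \<in> dom_fun f"
  proof (rule ccontr)
    assume "x \<notin> dom_fun f"
    then have "f x = \<infinity>" by (rule not_dom_fun[where f = f, OF fin])
    moreover obtain v where "f y = ereal v" using y by (rule dom_funE)
    ultimately show False using le[of y] by simp
  qed
  have "real_part f x + blinfun_apply c (y - x) \<le> real_part f y" if y: "y \<in> dom_fun f" for y
  proof -
    obtain u where "f x = ereal u" using x by (rule dom_funE)
    moreover obtain v where "f y = ereal v" using y by (rule dom_funE)
    ultimately show ?thesis using le[of y] by simp
  qed
  then show "subgradient_on (dom_fun f) (real_part f) x c" using x by (simp add: subgradient_on_def)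
next
  assume c: "subgradient_on (dom_fun f) (real_part f) x c"
  have "ereal (blinfun_apply c (y - x)) + f x \<le> f y" for y
  proof (cases "y \<in> dom_fun f")
    case True
    have "x \<in> dom_fun f" using c by (simp add: subgradient_on_def)
    then obtain u where "f x = ereal u" by (rule dom_funE)
    moreover obtain v where "f y = ereal v" using True by (rule dom_funE)
    ultimately show ?thesis using c True by (auto simp: subgradient_on_def)
  qed (simp add: not_dom_fun[where f = f, OF fin])
  then show "c \<in> subdiff f x" by (simp add: subdiff_def)
qed

lemma lower_semicontinuousD:
  assumes "lower_semicontinuous f" "c < f x"
  obtains d where "d > 0" "\<And>y. dist y x < d \<Longrightarrow> c < f y"
  using assms unfolding lower_semicontinuous_def eventually_nhds_metric by blast

lemma lower_semicontinuous_le_limit: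
  fixes f :: "'a::metric_space \<Rightarrow> ereal" and h :: "'a \<Rightarrow> real"
  assumes f: "lower_semicontinuous f" and h: "isCont h z"
    and near: "\<And>e. e > 0 \<Longrightarrow> \<exists>y. dist y z < e \<and> f y \<le> ereal (h y)"
  shows "f z \<le> ereal (h z)"
proof (rule ccontr)
  assume "\<not> ?thesis"
  then obtain c where c: "ereal (h z) < ereal c" "ereal c < f z"
    using ereal_dense2[of "ereal (h z)" "f z"] by (auto simp: not_le)
  obtain d1 where d1: "d1 > 0" "\<And>y. dist y z < d1 \<Longrightarrow> ereal c < f y"
    using lower_semicontinuousD[OF f c(2)] by blast
  have "h z < c" using c by simp
  then have "eventually (\<lambda>y. h y < c) (nhds z)"
    using h by (intro order_tendstoD(2)[of h "h z"]) (auto simp: isCont_def tendsto_nhds_iff)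
  then obtain d2 where d2: "d2 > 0" "\<And>y. dist y z < d2 \<Longrightarrow> h y < c"
    unfolding eventually_nhds_metric by blast
  obtain y where y: "dist y z < min d1 d2" "f y \<le> ereal (h y)"
    using near[of "min d1 d2"] d1 d2 by auto
  then have "ereal c < f y" "h y < c" using d1(2)[of y] d2(2)[of y] by auto
  with y(2) have "ereal c < ereal (h y)" by (blast intro: less_le_trans)
  with \<open>h y < c\<close> show False by simp
qed

text \<open>The ball around the convex combination is the image of the ball around $x$ under the homothety
with centre $z$ and ratio $s$, and convexity transports the bound along the segments from $z$.\<close>

lemma bounded_above_toward_interior:
  fixes g :: "'a::real_normed_vector \<Rightarrow> real"
  assumes g: "convex_on K g" and z: "z \<in> K" and ball: "cball x r \<subseteq> K"
    and N: "\<And>y. y \<in> cball x r \<Longrightarrow> g y \<le> N" and s: "0 < s" "s \<le> 1"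
    and y: "y \<in> cball ((1 - s) *\<^sub>R z + s *\<^sub>R x) (s * r)"
  shows "y \<in> K" "g y \<le> (1 - s) * g z + s * N"
proof -
  define p where "p = (1 - s) *\<^sub>R z + s *\<^sub>R x"
  define v where "v = x + (1 / s) *\<^sub>R (y - p)"
  have "norm (y - p) \<le> s * r" using y by (simp add: p_def dist_norm norm_minus_commute)
  then have "norm (v - x) \<le> r" using s by (simp add: v_def pos_divide_le_eq mult.commute)
  then have v: "v \<in> cball x r" by (simp add: dist_norm norm_minus_commute)
  have "s *\<^sub>R v = s *\<^sub>R x + (y - p)" using s by (simp add: v_def scaleR_add_right)
  then have yv: "y = (1 - s) *\<^sub>R z + s *\<^sub>R v" by (simp add: p_def)
  show "y \<in> K"
    unfolding yv using v ball s z by (intro convexD[OF convex_on_imp_convex[OF g]]) auto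
  have "g y \<le> (1 - s) * g z + s * g v"
    unfolding yv using v ball s z by (intro convex_onD[OF g]) auto
  then show "g y \<le> (1 - s) * g z + s * N"
    using mult_left_mono[OF N[OF v], of s] s by linarith
qed

text \<open>By lower semicontinuity the sublevel sets for the levels $n$ are closed in a closed ball around
$x_0$, which they cover; by Baire's theorem one of them has interior points relative to the ball.
Thus $f$ is bounded above on a genuine ball around some $p$, and the bound is carried to $x_0$,
which is the midpoint of $p$ and of its reflection in $x_0$.\<close>

lemma bounded_above_near_interior:
  fixes f :: "'a::banach \<Rightarrow> ereal"
  assumes f: "lower_semicontinuous f" and g: "convex_on (dom_fun f) (real_part f)"
    and x0: "x0 \<in> interior (dom_fun f)"
  obtains r N where "r > 0" "cball x0 r \<subseteq> dom_fun f"
    "\<And>x. x \<in> cball x0 r \<Longrightarrow> real_part f x \<le> N"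
proof -
  obtain R where R: "R > 0" "cball x0 R \<subseteq> dom_fun f"
    using x0 by (meson interior_subset open_interior open_contains_cball subset_trans)
  define B where "B = cball x0 R"
  define T where "T = (\<lambda>n::nat. {x\<in>B. real_part f x \<le> real n})"
  have BK: "B \<subseteq> dom_fun f" using R by (simp add: B_def)
  have closedT: "closed (T n)" for n
  proof -
    have "\<exists>e>0. ball x e \<subseteq> - T n" if x: "x \<notin> T n" for x
    proof (cases "x \<in> B")
      case False
      then have "x \<in> - B" "open (- B)" by (auto simp: B_def open_Compl)
      then obtain e where "e > 0" "ball x e \<subseteq> - B" using open_contains_ball by blast
      then show ?thesis by (auto simp: T_def)
    next
      case True
      then have "ereal (real n) < ereal (real_part f x)" using x by (simp add: T_def)
      moreover have "x \<in> dom_fun f" using True BK by blast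
      ultimately have "ereal (real n) < f x" using dom_fun_real_part[of x f] by metis
      then obtain e where e: "e > 0" "\<And>y. dist y x < e \<Longrightarrow> ereal (real n) < f y"
        using lower_semicontinuousD[OF f] by blast
      have "y \<notin> T n" if y: "y \<in> ball x e" for y
      proof
        assume yT: "y \<in> T n"
        then have "y \<in> dom_fun f" using BK by (auto simp: T_def)
        then obtain v where "f y = ereal v" by (rule dom_funE)
        then show False using yT e(2)[of y] y by (simp add: T_def dist_commute)
      qed
      then show ?thesis using e(1) by blast
    qed
    then have "open (- T n)" by (auto simp: open_contains_ball)
    then show ?thesis by (simp add: closed_def)
  qed
  have "\<exists>n. top_of_set B interior_of T n \<noteq> {}"
  proof (rule ccontr)
    assume "\<not> ?thesis"
    then have "top_of_set B interior_of \<Union>(range T) = {}"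
      using closedT completely_metrizable_space_closedin[OF completely_metrizable_space_euclidean, of B]
      by (intro Baire_category_alt) (auto simp: B_def T_def intro: closed_subset)
    moreover have "\<Union>(range T) = B"
      using real_arch_simple by (auto simp: T_def)
    moreover have "top_of_set B interior_of B = B"
      using interior_of_topspace[of "top_of_set B"] by simp
    moreover have "x0 \<in> B" using R by (simp add: B_def)
    ultimately show False by simp
  qed
  then obtain n q U where U: "openin (top_of_set B) U" "q \<in> U" "U \<subseteq> T n"
    unfolding interior_of_def by blast
  then obtain W where W: "open W" "U = B \<inter> W" by (auto simp: openin_open)
  obtain e where e: "e > 0" "ball q e \<subseteq> W" using W U(2) open_contains_ball by blast
  \<comment> \<open>A step from $q$ towards $x_0$: small enough that the new point $p$ stays well inside the open
    set around $q$, and leaving room for a ball of radius $s R$ around $p$ inside $B$.\<close>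
  define s where "s = min 1 (e / (4 * R))"
  have s: "0 < s" "s \<le> 1" "s * R \<le> e / 4" using e R by (auto simp: s_def min_def field_simps)
  define p where "p = (1 - s) *\<^sub>R q + s *\<^sub>R x0"
  define \<rho> where "\<rho> = s * R"
  have qB: "norm (q - x0) \<le> R" using U(2) W by (simp add: B_def dist_norm norm_minus_commute)
  have "p - q = s *\<^sub>R (x0 - q)" by (simp add: p_def algebra_simps)
  then have "norm (p - q) = s * norm (q - x0)" using s by (simp add: norm_minus_commute)
  also have "\<dots> \<le> s * R" using qB s by (intro mult_left_mono) auto
  finally have pq: "norm (p - q) \<le> e / 4" using s by simp
  have px: "p - x0 = (1 - s) *\<^sub>R (q - x0)" by (simp add: p_def algebra_simps)
  have px_norm: "norm (p - x0) \<le> (1 - s) * R"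
    unfolding px using s mult_left_mono[OF qB, of "1 - s"] by simp
  have inT: "y \<in> T n" if "norm (y - p) \<le> \<rho>" for y
  proof -
    have "norm (y - q) \<le> e / 4 + e / 4"
      using norm_triangle_ineq[of "y - p" "p - q"] that pq s by (simp add: \<rho>_def)
    then have "y \<in> W" using e by (auto simp: dist_norm norm_minus_commute)
    moreover have "norm (y - x0) \<le> R"
      using norm_triangle_ineq[of "y - p" "p - x0"] that px_norm by (simp add: \<rho>_def algebra_simps)
    then have "y \<in> B" by (simp add: B_def dist_norm norm_minus_commute)
    ultimately show ?thesis using U W by blast
  qed
  define p' where "p' = 2 *\<^sub>R x0 - p"
  have "norm (p' - x0) = norm (p - x0)" by (simp add: p'_def scaleR_2 norm_minus_commute)
  also have "\<dots> \<le> R" using px_norm s R by (smt (verit) mult_left_le_one_le)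
  finally have p': "p' \<in> B" by (simp add: B_def dist_norm norm_minus_commute)
  have ball: "cball p \<rho> \<subseteq> dom_fun f" "\<And>y. y \<in> cball p \<rho> \<Longrightarrow> real_part f y \<le> real n"
    using inT BK by (auto simp: T_def dist_norm norm_minus_commute)
  have mid: "(1 - 1/2) *\<^sub>R p' + (1/2) *\<^sub>R p = x0" by (simp add: p'_def flip: scaleR_add_right)
  have "p' \<in> dom_fun f" using p' BK by blast
  note near = bounded_above_toward_interior[OF g this ball, of "1/2", unfolded mid]
  show ?thesis
    using near s R by (intro that[of "1/2 * \<rho>"]) (auto simp: \<rho>_def)
qed

text \<open>A subgradient at $y$ is the sandwich functional for $g$ and the constant $-g(y)$ over a single
point. Its norm is bounded by the upper bound $N$ and a lower bound for $g(y)$; the latter comes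
from reflecting $y$ in $p$.\<close>

lemma subgradients_bounded_near:
  fixes g :: "'a::real_normed_vector \<Rightarrow> real"
  assumes g: "convex_on K g" and r: "r > 0" and ball: "cball p r \<subseteq> K"
    and N: "\<And>x. x \<in> cball p r \<Longrightarrow> g x \<le> N"
  obtains L where "L \<ge> 0"
    "\<And>y. y \<in> cball p (r / 2) \<Longrightarrow> \<exists>c. subgradient_on K g y c \<and> norm c \<le> L"
proof -
  define L where "L = (2 * N - 2 * g p) / (r / 2)"
  have p: "p \<in> cball p r" using r by simp
  have "\<exists>c. subgradient_on K g y c \<and> norm c \<le> L" if y: "y \<in> cball p (r / 2)" for y
  proof -
    have yK: "y \<in> K" "y \<in> cball p r" using y r ball by auto
    define y' where "y' = 2 *\<^sub>R p - y"
    have y': "y' \<in> cball p r" using yK by (simp add: y'_def dist_norm scaleR_2 norm_minus_commute)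
    have "g ((1 - 1/2) *\<^sub>R y + (1/2) *\<^sub>R y') \<le> (1 - 1/2) * g y + (1/2) * g y'"
      using yK y' ball by (intro convex_onD[OF g]) auto
    also have "(1 - 1/2) *\<^sub>R y + (1/2) *\<^sub>R y' = p" by (simp add: y'_def flip: scaleR_add_right)
    finally have gy: "2 * g p - N \<le> g y" using N[OF y'] by simp
    have sub: "cball y (r / 2) \<subseteq> cball p r"
    proof
      fix v assume "v \<in> cball y (r / 2)"
      then show "v \<in> cball p r" using y dist_triangle[of p v y] by simp
    qed
    obtain w :: "'a \<Rightarrow>\<^sub>L real" where w: "norm w \<le> (N + - g y) / (r / 2)"
      "\<And>x c. x \<in> K \<Longrightarrow> c \<in> {y} \<Longrightarrow> 0 \<le> g x + - g y + blinfun_apply w (id c - x)"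
      by (rule sandwich_with_slope_bound[OF g, of "{y}" "\<lambda>_. - g y" id y "r/2" N])
        (use sub ball N r in \<open>auto simp: convex_on_const linear_id\<close>)
    have "norm w \<le> L"
      using w(1) divide_right_mono[of "N + - g y" "2 * N - 2 * g p" "r / 2"] gy r by (simp add: L_def)
    moreover have "subgradient_on K g y w"
      unfolding subgradient_on_def
    proof (intro conjI ballI yK)
      fix x assume "x \<in> K"
      from w(2)[OF this, of y] show "g y + blinfun_apply w (x - y) \<le> g x"
        by (simp add: blinfun.bilinear_simps)
    qed
    ultimately show ?thesis by blast
  qed
  moreover have "L \<ge> 0" using N[OF p] r by (simp add: L_def)
  ultimately show ?thesis using that by blast
qed

lemma sublinear_real_part:
  assumes fin: "\<And>x. f x \<noteq> -\<infinity>" and f: "sublinear f"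
  shows "0 \<in> dom_fun f" "real_part f 0 = 0"
    and "\<And>x y. x \<in> dom_fun f \<Longrightarrow> y \<in> dom_fun f \<Longrightarrow>
        x + y \<in> dom_fun f \<and> real_part f (x + y) \<le> real_part f x + real_part f y"
    and "\<And>x l. x \<in> dom_fun f \<Longrightarrow> l > 0 \<Longrightarrow>
        l *\<^sub>R x \<in> dom_fun f \<and> real_part f (l *\<^sub>R x) = l * real_part f x"
proof -
  have "f 0 = ereal 0" using f by (simp add: sublinear_def zero_ereal_def)
  then show "0 \<in> dom_fun f" "real_part f 0 = 0" by (simp_all add: dom_fun_def)
next
  fix x y assume xy: "x \<in> dom_fun f" "y \<in> dom_fun f"
  obtain u where u: "f x = ereal u" using xy(1) by (rule dom_funE)
  obtain v where v: "f y = ereal v" using xy(2) by (rule dom_funE)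
  have "f (x + y) \<le> f x + f y" using f xy unfolding sublinear_def by blast
  then have le: "f (x + y) \<le> ereal (u + v)" by (simp add: u v)
  then obtain w where w: "f (x + y) = ereal w"
    using fin[of "x + y"] by (cases "f (x + y)") auto
  then show "x + y \<in> dom_fun f \<and> real_part f (x + y) \<le> real_part f x + real_part f y"
    using le u v by (auto simp: dom_fun_def)
next
  fix x and l :: real assume x: "x \<in> dom_fun f" "l > 0"
  obtain u where u: "f x = ereal u" using x(1) by (rule dom_funE)
  have "f (l *\<^sub>R x) = ereal l * f x" using f x unfolding sublinear_def by blast
  then have "f (l *\<^sub>R x) = ereal (l * u)" using u by simp
  then show "l *\<^sub>R x \<in> dom_fun f \<and> real_part f (l *\<^sub>R x) = l * real_part f x"
    using u by (auto simp: dom_fun_def)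
qed

lemma sublinear_imp_convex_on:
  assumes fin: "\<And>x. f x \<noteq> -\<infinity>" and f: "sublinear f"
  shows "convex_on (dom_fun f) (real_part f)"
proof -
  have comb: "(1 - t) *\<^sub>R x + t *\<^sub>R y \<in> dom_fun f \<and>
      real_part f ((1 - t) *\<^sub>R x + t *\<^sub>R y) \<le> (1 - t) * real_part f x + t * real_part f y"
    if "0 < t" "t < 1" "x \<in> dom_fun f" "y \<in> dom_fun f" for t x y
    using sublinear_real_part(3)[OF fin f, of "(1 - t) *\<^sub>R x" "t *\<^sub>R y"]
      sublinear_real_part(4)[OF fin f that(3), of "1 - t"] sublinear_real_part(4)[OF fin f that(4), of t] that
    by simp
  have "convex (dom_fun f)"
    unfolding convex_alt
  proof (intro ballI allI impI)
    fix x y and t :: real assume "x \<in> dom_fun f" "y \<in> dom_fun f" "0 \<le> t \<and> t \<le> 1"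
    then show "(1 - t) *\<^sub>R x + t *\<^sub>R y \<in> dom_fun f"
      using comb[of t x y] by (cases "t = 0 \<or> t = 1") auto
  qed
  then show ?thesis using comb by (intro convex_onI) blast+
qed

text \<open>A lower semicontinuous sublinear function is the supremum of its subgradients at $0$. Lower
semicontinuity at $0$ and homogeneity give $g(y) \ge -m\|y\|$; together with lower
semicontinuity at $z$ this gives $g(y) - s r + M \|s z - y\| \ge 0$ for all $s \ge 0$ and a
suitable $M$. The norm is replaced by a functional $w$; the choice $s = 0$ says $w \le g$ and the
choice $y = 0$, $s = 1$ says $w(z) \ge r$.\<close>

lemma sublinear_support_functional:
  fixes f :: "'a::real_normed_vector \<Rightarrow> ereal"
  assumes fin: "\<And>x. f x \<noteq> -\<infinity>" and lsc: "lower_semicontinuous f" and f: "sublinear f"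
    and r: "ereal r < f z"
  obtains c where "subgradient_on (dom_fun f) (real_part f) 0 c" "r \<le> blinfun_apply c z"
proof -
  define K where "K = dom_fun f"
  define g where "g = real_part f"
  note pos = sublinear_real_part[OF fin f, folded K_def g_def]
  have fg: "f x = ereal (g x)" if "x \<in> K" for x
    unfolding g_def using that[unfolded K_def] by (rule dom_fun_real_part)
  obtain d where d: "d > 0" "\<And>y. dist y z < d \<Longrightarrow> ereal r < f y"
    using lower_semicontinuousD[OF lsc r] by blast
  have "ereal (-1) < f 0" using fg[OF pos(1)] pos(2) by simp
  then obtain e where e: "e > 0" "\<And>y. dist y 0 < e \<Longrightarrow> ereal (-1) < f y"
    using lower_semicontinuousD[OF lsc] by blast
  \<comment> \<open>Scaling $y$ to norm $e / 2$, where $g$ exceeds $-1$, gives the slope $2 / e$.\<close>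
  define m where "m = 2 / e"
  have m: "m > 0" using e by (simp add: m_def)
  have low: "- m * norm y \<le> g y" if y: "y \<in> K" for y
  proof (cases "y = 0")
    case False
    define l where "l = e / (2 * norm y)"
    have l: "l > 0" using False e by (simp add: l_def)
    have "dist (l *\<^sub>R y) 0 < e" using False e by (simp add: l_def)
    then have "ereal (-1) < f (l *\<^sub>R y)" by (rule e(2))
    then have "- 1 < l * g y" using fg[of "l *\<^sub>R y"] pos(4)[OF y l] by simp
    then have "- (1 / l) < g y" using l by (simp add: field_simps)
    then show ?thesis using False e by (simp add: l_def m_def)
  qed (simp add: pos(2))
  \<comment> \<open>Near $z$ the function itself exceeds $r$; at distance at least $d$ from $z$ the second summand
    compensates for the linear lower bound and for $r$.\<close>
  define M where "M = m + (m * norm z + \<bar>r\<bar>) / d"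
  have M: "m \<le> M" "0 \<le> M" using m d by (auto simp: M_def intro!: add_nonneg_nonneg divide_nonneg_pos)
  have at_one: "0 \<le> M * norm (z - y) + (g y - r)" if y: "y \<in> K" for y
  proof (cases "norm (z - y) < d")
    case True
    then have "r < g y" using d(2)[of y] fg[OF y] by (simp add: dist_norm norm_minus_commute)
    moreover have "0 \<le> M * norm (z - y)" using M by simp
    ultimately show ?thesis by linarith
  next
    case False
    have "m * norm z + \<bar>r\<bar> = (m * norm z + \<bar>r\<bar>) / d * d" using d by simp
    also have "\<dots> \<le> (m * norm z + \<bar>r\<bar>) / d * norm (z - y)"
      using False d m by (intro mult_left_mono divide_nonneg_pos add_nonneg_nonneg) auto
    finally have 1: "m * norm z + \<bar>r\<bar> \<le> (M - m) * norm (z - y)" by (simp add: M_def)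
    have "norm y \<le> norm z + norm (z - y)"
      using norm_triangle_ineq4[of z "z - y"] by simp
    then have "m * norm y \<le> m * (norm z + norm (z - y))" using m by simp
    then show ?thesis using 1 low[OF y] abs_ge_self[of r] by (simp add: algebra_simps)
  qed
  define j where "j = (\<lambda>(y :: 'a, s :: real). s *\<^sub>R z - y)"
  define k where "k = (\<lambda>(y, s). g y - s * r)"
  have lin: "linear j"
    by (rule linearI) (auto simp: j_def algebra_simps)
  have gconv: "convex_on K g" unfolding K_def g_def by (rule sublinear_imp_convex_on[OF fin f])
  have conv: "convex_on (K \<times> {0..}) k"
  proof (rule convex_onI)
    show "convex (K \<times> {0::real..})"
      using gconv by (intro convex_Times convex_on_imp_convex) auto
    fix t :: real and u v assume "0 < t" "t < 1" "u \<in> K \<times> {0::real..}" "v \<in> K \<times> {0::real..}"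
    then show "k ((1 - t) *\<^sub>R u + t *\<^sub>R v) \<le> (1 - t) * k u + t * k v"
      using convex_onD[OF gconv, of t "fst u" "fst v"]
      by (auto simp: k_def case_prod_beta algebra_simps)
  qed
  have ne: "K \<times> {0::real..} \<noteq> {}" using pos(1) by auto
  have nonneg: "0 \<le> M * norm (j c) + k c" if cK: "c \<in> K \<times> {0..}" for c
  proof -
    obtain y s where c: "c = (y, s)" "y \<in> K" "s \<ge> 0" using cK by auto
    show ?thesis
    proof (cases "s = 0")
      case True
      have "m * norm y \<le> M * norm y" using M by (intro mult_right_mono) auto
      then show ?thesis using low[OF c(2)] by (simp add: c True j_def k_def)
    next
      case False
      then have s: "s > 0" using c by simp
      have h: "(1 / s) *\<^sub>R y \<in> K" "g ((1 / s) *\<^sub>R y) = g y / s" using pos(4)[OF c(2), of "1 / s"] s by auto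
      have "s *\<^sub>R z - y = s *\<^sub>R (z - (1 / s) *\<^sub>R y)" using s by (simp add: scaleR_diff_right)
      then have n: "norm (s *\<^sub>R z - y) = s * norm (z - (1 / s) *\<^sub>R y)" using s by simp
      have "0 \<le> s * (M * norm (z - (1 / s) *\<^sub>R y) + (g y / s - r))"
        using at_one[OF h(1)] s by (simp add: h(2))
      also have "\<dots> = M * norm (s *\<^sub>R z - y) + (g y - s * r)"
        unfolding n using s by (simp add: algebra_simps)
      finally show ?thesis by (simp add: c j_def k_def)
    qed
  qed
  obtain w :: "'a dual" where w: "\<And>c. c \<in> K \<times> {0..} \<Longrightarrow> 0 \<le> blinfun_apply w (j c) + k c"
    using bounded_Hahn_Banach_Lagrange[OF lin conv ne M(2) nonneg] by blast
  have "r \<le> blinfun_apply w z"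
    using w[of "(0, 1)"] pos(1,2) by (simp add: j_def k_def)
  moreover have "blinfun_apply w y \<le> g y" if "y \<in> K" for y
    using w[of "(y, 0)"] that by (simp add: j_def k_def blinfun.bilinear_simps)
  then have "subgradient_on K g 0 w" using pos(1,2) by (simp add: subgradient_on_def)
  ultimately show ?thesis using that by (simp add: K_def g_def)
qed

section \<open>The gap inequality and the sum theorem\<close>

lemma monotone_sum_subgradients:
  assumes "monotone_op A" "a \<in> A x" "b \<in> A y" "subgradient_on K g x c" "subgradient_on K g y d"
  shows "0 \<le> blinfun_apply ((a + c) - (b + d)) (x - y)"
proof -
  have "g x + blinfun_apply c (y - x) \<le> g y" "g y + blinfun_apply d (x - y) \<le> g x"
    using assms(4,5) by (auto simp: subgradient_on_def)
  then show ?thesis using monotone_opD[OF assms(1-3)] by (simp add: blinfun.bilinear_simps)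
qed

text \<open>With $p = (1-s) z + s x$ one has $(1-s)(z - y) = (p - y) + s (y - x)$. The relation tested at a
graph point $(y, b)$ with subgradient $c$, multiplied by $1 - s$, is therefore the sum of two
terms. For $y$ chosen by
\<open>graph_point_near_closure\<close>, the term along $p - y$ is nonpositive, so the term along
$y - x$ is nonnegative; in it $b$ may be replaced by $a$ by monotonicity of $A$, and the
subgradient inequality for $c$ brings in $g(x)$ and $g(y)$. The point $p$ is needed because
subgradients exist and are bounded near $p$, while $z$ may be a boundary point of $K$.\<close>

lemma approximate_gap_inequality:
  fixes A :: "'a::real_normed_vector set_valued"
  assumes A: "maximal_monotone A" "linear_relation A" and g: "convex_on K g"
    and z: "z \<in> K" "z \<in> closure (dom_op A)"
    and rel: "\<And>y b c. b \<in> A y \<Longrightarrow> subgradient_on K g y c \<Longrightarrow> 0 \<le> blinfun_apply (z' - (b + c)) (z - y)"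
    and a: "a \<in> A x" and r: "r > 0" and ball: "cball x r \<subseteq> K"
    and N: "\<And>y. y \<in> cball x r \<Longrightarrow> g y \<le> N" and e: "e > 0"
  obtains y where "y \<in> K" "dist y z < e" "g y \<le> g x + blinfun_apply (z' - a) (y - x)"
proof -
  \<comment> \<open>Chosen so that $p$ is within $e / 2$ of $z$; the summand $1$ covers the case $x = z$.\<close>
  define s where "s = min 1 (e / (2 * (norm (x - z) + 1)))"
  have pos: "2 * (norm (x - z) + 1) > 0" by (intro mult_pos_pos add_nonneg_pos) auto
  have s: "0 < s" "s \<le> 1" using e pos by (auto simp: s_def)
  have "s * (2 * (norm (x - z) + 1)) \<le> e / (2 * (norm (x - z) + 1)) * (2 * (norm (x - z) + 1))"
    using pos by (intro mult_right_mono) (auto simp: s_def)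
  also have "\<dots> = e" using pos by simp
  finally have s_small: "s * norm (x - z) \<le> e / 2" using s by (simp add: algebra_simps)
  define p where "p = (1 - s) *\<^sub>R z + s *\<^sub>R x"
  have "p - z = s *\<^sub>R (x - z)" by (simp add: p_def algebra_simps)
  then have pz: "dist p z \<le> e / 2" using s s_small by (simp add: dist_norm)
  have bnd: "cball p (s * r) \<subseteq> K"
    "\<And>y. y \<in> cball p (s * r) \<Longrightarrow> g y \<le> (1 - s) * g z + s * N"
    using bounded_above_toward_interior[OF g z(1) ball N s] by (auto simp: p_def)
  obtain L where L: "L \<ge> 0"
    "\<And>y. y \<in> cball p (s * r / 2) \<Longrightarrow> \<exists>c. subgradient_on K g y c \<and> norm c \<le> L"
    using subgradients_bounded_near[OF g _ bnd] s r by auto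
  have "x \<in> dom_op A" using a by (auto simp: dom_op_def)
  then have "x \<in> closure (dom_op A)" using closure_subset by blast
  then have p: "p \<in> closure (dom_op A)"
    unfolding p_def using z s subspace_imp_convex[OF subspace_dom_op[OF A(2)]]
    by (intro convexD[OF convex_closure]) auto
  define \<rho> where "\<rho> = min (e / 2) (s * r / 2)"
  have "\<rho> > 0" using e s r by (simp add: \<rho>_def)
  then obtain y b where y: "b \<in> A y" "dist y p < \<rho>"
    "blinfun_apply (z' - b) (p - y) \<le> - L * norm (p - y)"
    using graph_point_near_closure[OF A p _ L(1)] by blast
  have "y \<in> cball p (s * r / 2)" using y(2) by (simp add: \<rho>_def dist_commute)
  then obtain c where c: "subgradient_on K g y c" "norm c \<le> L" using L(2) by blast
  have "\<bar>blinfun_apply c (p - y)\<bar> \<le> L * norm (p - y)"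
    using norm_blinfun[of c "p - y"] mult_right_mono[OF c(2), of "norm (p - y)"] by simp
  then have near: "blinfun_apply (z' - (b + c)) (p - y) \<le> 0"
    using y(3) by (simp add: blinfun.bilinear_simps)
  have "(1 - s) *\<^sub>R (z - y) = (p - y) + s *\<^sub>R (y - x)"
    by (simp add: p_def algebra_simps)
  then have "(1 - s) * blinfun_apply (z' - (b + c)) (z - y)
      = blinfun_apply (z' - (b + c)) (p - y) + s * blinfun_apply (z' - (b + c)) (y - x)"
    by (metis blinfun.add_right blinfun.scaleR_right real_scaleR_def)
  moreover have "0 \<le> (1 - s) * blinfun_apply (z' - (b + c)) (z - y)"
    using rel[OF y(1) c(1)] s by simp
  ultimately have "0 \<le> s * blinfun_apply (z' - (b + c)) (y - x)" using near by linarith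
  then have "0 \<le> blinfun_apply (z' - (b + c)) (y - x)" using s by (simp add: zero_le_mult_iff)
  moreover have "0 \<le> blinfun_apply (b - a) (y - x)"
    using monotone_opD[OF _ y(1) a] A(1) by (simp add: maximal_monotone_def)
  moreover have xK: "x \<in> K" using ball r by auto
  then have "g y + blinfun_apply c (x - y) \<le> g x" using c(1) by (simp add: subgradient_on_def)
  ultimately have "g y \<le> g x + blinfun_apply (z' - a) (y - x)"
    by (simp add: blinfun.bilinear_simps)
  moreover have "dist y z < e"
    using dist_triangle[of y z p] y(2) pz by (simp add: \<rho>_def)
  ultimately show ?thesis using c(1) that by (auto simp: subgradient_on_def)
qed

text \<open>Points of the segment from $x$ to $x_0$ other than $x$ have a neighbourhood on which $g$ is
bounded above. Both terms on the right-hand side are convex along the corresponding segment in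
the graph of $A$, so the inequality passes to the endpoint $x$.\<close>

lemma gap_inequality_extends:
  assumes A: "monotone_op A" "linear_relation A" and g: "convex_on K g"
    and ball: "cball x0 r \<subseteq> K" and r: "r > 0" and N: "\<And>y. y \<in> cball x0 r \<Longrightarrow> g y \<le> N"
    and a0: "a0 \<in> A x0" and a: "a \<in> A x" and x: "x \<in> K"
    and gap: "\<And>y b s M. b \<in> A y \<Longrightarrow> s > 0 \<Longrightarrow> cball y s \<subseteq> K \<Longrightarrow> (\<And>v. v \<in> cball y s \<Longrightarrow> g v \<le> M)
        \<Longrightarrow> m \<le> g y + blinfun_apply (z' - b) (z - y)"
  shows "m \<le> g x + blinfun_apply (z' - a) (z - x)"
proof -
  define h where "h = (\<lambda>(y, b). blinfun_apply (z' - b) (z - y))"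
  define \<alpha> where "\<alpha> = g x + h (x, a)"
  define \<beta> where "\<beta> = g x0 + h (x0, a0)"
  have x0: "x0 \<in> K" using ball r by auto
  have le: "m \<le> (1 - s) * \<alpha> + s * \<beta>" if s: "0 < s" "s < 1" for s
  proof -
    define y where "y = (1 - s) *\<^sub>R x + s *\<^sub>R x0"
    define b where "b = (1 - s) *\<^sub>R a + s *\<^sub>R a0"
    have "b \<in> A y" unfolding b_def y_def by (rule linear_relation_combine[OF A(2) a a0])
    then have "m \<le> g y + blinfun_apply (z' - b) (z - y)"
    proof (rule gap)
      note near = bounded_above_toward_interior[OF g x ball N s(1) less_imp_le[OF s(2)], folded y_def]
      show "s * r > 0" using s r by simp
      show "cball y (s * r) \<subseteq> K" using near(1) by blast
      show "g v \<le> (1 - s) * g x + s * N" if "v \<in> cball y (s * r)" for v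
        by (rule near(2)[OF _ that])
    qed
    then have "m \<le> g y + h (y, b)" by (simp add: h_def)
    also have "g y \<le> (1 - s) * g x + s * g x0"
      unfolding y_def using s x x0 by (intro convex_onD[OF g]) auto
    also have "h (y, b) \<le> (1 - s) * h (x, a) + s * h (x0, a0)"
      using convex_onD[OF convex_on_monotone_gap[OF A(2,1), of z' z], of s "(x, a)" "(x0, a0)"] s a a0
      by (simp add: h_def y_def b_def gra_def)
    finally show ?thesis by (simp add: \<alpha>_def \<beta>_def algebra_simps)
  qed
  have "((\<lambda>s. (1 - s) * \<alpha> + s * \<beta>) \<longlongrightarrow> (1 - 0) * \<alpha> + 0 * \<beta>) (at_right 0)"
    by (intro tendsto_intros)
  moreover have "eventually (\<lambda>s. m \<le> (1 - s) * \<alpha> + s * \<beta>) (at_right 0)"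
    using le by (intro eventually_at_rightI[of 0 1]) auto
  ultimately have "m \<le> (1 - 0) * \<alpha> + 0 * \<beta>"
    by (intro tendsto_lowerbound) auto
  then show ?thesis by (simp add: \<alpha>_def h_def)
qed

theorem theorem3p1:
  fixes A :: "'a::banach set_valued"
    and f :: "'a \<Rightarrow> ereal"
  assumes "maximal_monotone A"
    and "linear_relation A"
    and "\<And>x. f x \<noteq> -\<infinity>"
    and "proper_fun f"
    and "lower_semicontinuous f"
    and "sublinear f"
    and "dom_op A \<inter> interior (dom_op (subdiff f)) \<noteq> {}"
  shows "maximal_monotone (sum_op A (subdiff f))"
proof -
  define K where "K = dom_fun f"
  define g where "g = real_part f"
  note A = assms(1,2) and fin = assms(3) and lsc = assms(5) and sub = assms(6)
  have mono: "monotone_op A" using A by (simp add: maximal_monotone_def)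
  have sd: "c \<in> subdiff f x \<longleftrightarrow> subgradient_on K g x c" for c x
    unfolding K_def g_def using subdiff_iff_subgradient_on[of f, OF fin assms(4)] .
  have g: "convex_on K g" unfolding K_def g_def by (rule sublinear_imp_convex_on[OF fin sub])
  have fg: "f x = ereal (g x)" if "x \<in> K" for x
    unfolding g_def using that[unfolded K_def] by (rule dom_fun_real_part)
  have zero: "0 \<in> K" "g 0 = 0" using sublinear_real_part(1,2)[OF fin sub] by (auto simp: K_def g_def)
  have "dom_op (subdiff f) \<subseteq> K"
    by (auto simp: dom_op_def sd subgradient_on_def)
  then have "interior (dom_op (subdiff f)) \<subseteq> interior K" by (rule interior_mono)
  then obtain x0 where x0: "x0 \<in> dom_op A" "x0 \<in> interior K" using assms(7) by blast
  obtain r N where r: "r > 0" and ball: "cball x0 r \<subseteq> K" and N: "\<And>x. x \<in> cball x0 r \<Longrightarrow> g x \<le> N"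
    using bounded_above_near_interior[OF lsc, folded K_def g_def, OF g x0(2)] by blast
  obtain a0 where a0: "a0 \<in> A x0" using x0(1) by (auto simp: dom_op_def)
  have "monotone_op (sum_op A (subdiff f))"
  proof -
    have "0 \<le> blinfun_apply (u - v) (x - y)"
      if u: "u \<in> sum_op A (subdiff f) x" and v: "v \<in> sum_op A (subdiff f) y" for u v x y
    proof -
      obtain a c b d where "u = a + c" "a \<in> A x" "subgradient_on K g x c"
        "v = b + d" "b \<in> A y" "subgradient_on K g y d"
        using u v by (auto simp: sum_op_def sd)
      then show ?thesis using monotone_sum_subgradients[OF mono] by blast
    qed
    then show ?thesis unfolding monotone_op_def gra_def by blast
  qed
  then show ?thesis
  proof (rule maximal_monotoneI)
    fix z z'
    assume rel0: "\<And>x u. u \<in> sum_op A (subdiff f) x \<Longrightarrow> 0 \<le> blinfun_apply (z' - u) (z - x)"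
    have rel: "0 \<le> blinfun_apply (z' - (a + c)) (z - x)"
      if "a \<in> A x" "subgradient_on K g x c" for a c x
      using rel0[of "a + c" x] that by (auto simp: sum_op_def sd)
    have "f z \<le> ereal (blinfun_apply z' z)"
    proof (rule ccontr)
      assume "\<not> ?thesis"
      then obtain m where m: "ereal (blinfun_apply z' z) < ereal m" "ereal m < f z"
        using ereal_dense2[of "ereal (blinfun_apply z' z)" "f z"] by (auto simp: not_le)
      obtain c where "subgradient_on K g 0 c" "m \<le> blinfun_apply c z"
        using sublinear_support_functional[OF fin lsc sub m(2), folded K_def g_def] by blast
      then show False using rel[OF linear_relation_zero[OF A(2)], of c] m(1)
        by (simp add: blinfun.bilinear_simps)
    qed
    then have "f z \<noteq> \<infinity>" by auto
    then have z: "z \<in> K" using not_dom_fun[of f z, OF fin] unfolding K_def by blast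
    have "ereal (-1) < f 0" using fg[OF zero(1)] zero(2) by simp
    then obtain c0 where c0: "subgradient_on K g 0 c0"
      using sublinear_support_functional[OF fin lsc sub, folded K_def g_def] by blast
    have zD: "z \<in> closure (dom_op A)"
      using related_point_in_closure_dom[OF A, of z' c0 z] rel[of _ 0 c0] c0 by simp
    have gap_interior: "g z \<le> g y + blinfun_apply (z' - b) (z - y)"
      if b: "b \<in> A y" "s > 0" "cball y s \<subseteq> K" and M: "\<And>v. v \<in> cball y s \<Longrightarrow> g v \<le> M" for y b s M
    proof -
      have "f z \<le> ereal (g y + blinfun_apply (z' - b) (z - y))"
      proof (rule lower_semicontinuous_le_limit[OF lsc])
        show "isCont (\<lambda>v. g y + blinfun_apply (z' - b) (v - y)) z" by (intro continuous_intros)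
        fix e :: real assume "e > 0"
        then obtain v where "v \<in> K" "dist v z < e" "g v \<le> g y + blinfun_apply (z' - b) (v - y)"
          using approximate_gap_inequality[OF A g z zD rel b M] by blast
        then show "\<exists>v. dist v z < e \<and> f v \<le> ereal (g y + blinfun_apply (z' - b) (v - y))"
          using fg by (intro exI[of _ v]) simp
      qed
      then show ?thesis using fg[OF z] by simp
    qed
    have gap: "g z \<le> g x + blinfun_apply (z' - a) (z - x)" if "a \<in> A x" "x \<in> K" for a x
      by (rule gap_inequality_extends[OF mono A(2) g ball r N a0 that gap_interior])
    obtain w where w: "z' - w \<in> A z" "\<And>x. x \<in> K \<Longrightarrow> g z + blinfun_apply w (x - z) \<le> g x"
    proof (rule monotone_relation_splitting[OF A g z _ x0(1) r ball N])
      show "0 \<le> blinfun_apply (z' - a) (z - y) + (g y - g z)" if "a \<in> A y" "y \<in> K" for y a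
        using gap[OF that] by simp
    qed (assumption, rule that)
    then have "w \<in> subdiff f z" using z by (simp add: sd subgradient_on_def)
    moreover have "z' = (z' - w) + w" by simp
    ultimately show "z' \<in> sum_op A (subdiff f) z" using w(1) unfolding sum_op_def by blast
  qed
qed

end
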